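(* Let $k\ge 1$ and $f\ge 2$ be integers and let $\varepsilon>0$. Then there exists a constant $D=D(k,f,\varepsilon)$ with $D=O\bigl((k+f)/\varepsilon\bigr)$ (i.e. there is an absolute constant $C$ with $D(k,f,\varepsilon)\le C(k+f)/\varepsilon$ for all such $k,f$ and all $\varepsilon\in(0,1]$) such that the following holds. Let $I$ be any instance of maximizing a linear function $c^\top x$, $c\in\mathbb{R}^n_{\ge 0}$, over $\mathcal{F}_{A,b}=\{x\in\{0,1\}^n: Ax\le b\}$, where $Ax\le b$ is a system of generalized Horn constraints that is $k$-slack bounded. Then the optimal value $\mathrm{OPT}_D(I)$ of the $D$-SoS relaxation of $\mathcal{F}_{A,b}$ satisfies \[ \mathrm{OPT}(I)\;\le\;\mathrm{OPT}_D(I)\;\le\;(1+\varepsilon)\,\mathrm{OPT}^{(1)}_{\Lambda_f}(I), \] where $\mathrm{OPT}(I)=\max\{c^\top x: x\in\mathcal{F}_{A,b}\}$ and $\mathrm{OPT}^{(1)}_{\Lambda_f}(I)=\max\{c^\top x: x\in P^{(1)}_{\Lambda_f}\}$.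
   Context: Generalized Horn constraint: a linear constraint on $x\in\{0,1\}^n$ of the form $\sum_{i=1}^n a_i x_i - q\,x_j\le b$ for a designated index $j$, with $a_1,\dots,a_n,q,b\in\mathbb{Z}_{\ge 0}$ and $a_j=0$. A system of such constraints is $k$-slack bounded if each constraint satisfies $q\le k\cdot b$. System: $Ax\le b$ has $m$ rows, $A\in\mathbb{Z}^{m\times n}$, $b\in\mathbb{Z}^m_{\ge0}$, each row a generalized Horn constraint; the upper bounds $x_i\le 1$ ($i\in[n]$) are assumed to be among the rows of $Ax\le b$ (they are $k$-slack bounded with $q=0$), while the lower bounds $-x_i\le 0$ are treated separately. $P=\{x\in[0,1]^n: Ax\le b\}$. $\Lambda_f$-CG closure: $\Lambda_f=\{0\}\cup[1/f,1]$. A rank-1 $\Lambda_f$-CG cut is an inequality $(\lambda^\top A-\mu^\top)x\le\lfloor\lambda^\top b\rfloor$ with $\lambda\in\Lambda_f^m$, $\mu\in\mathbb{R}^n_{\ge 0}$ and $\lambda^\top A-\mu^\top\in\mathbb{Z}^n$ ($\mu_i$ is the multiplier of $-x_i\le 0$). $P^{(1)}_{\Lambda_f}$ is the intersection of $P$ with all rank-1 $\Lambda_f$-CG cuts. SoS relaxation: let $\mathcal{P}=\{P_j(x)\ge0\}$ be the list of linear constraints of $P$ (the rows $b_\ell-A_\ell x\ge 0$ and the box constraints $x_i\ge 0$, $1-x_i\ge0$). The $t$-SoS relaxation optimizes over pseudo-expectations: linear functionals $\tilde{\mathbb{E}}$ on multilinear polynomials of degree at most $2t+1$ with $\tilde{\mathbb{E}}[1]=1$,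 $\tilde{\mathbb{E}}[p^2]\ge0$ and $\tilde{\mathbb{E}}[p^2P_j]\ge0$ for every polynomial $p$ of degree at most $t$ and every $j$, products being reduced to multilinear form modulo the ideal $\langle x_i^2-x_i: i\in[n]\rangle$. A solution is identified with its first-moment vector $x^\ast\in[0,1]^n$, $x^\ast_i=\tilde{\mathbb{E}}[x_i]$. $\mathrm{OPT}_t(I)$ is the maximum of $\tilde{\mathbb{E}}[c^\top x]=c^\top x^\ast$ over all solutions of the $t$-SoS relaxation. *)

theory Defs
  imports Complex_Main "HOL-Library.FuncSet"
begin

text \<open>
  The dimensions \<open>n\<close> and \<open>m\<close> vary inside the statement, so indices are the naturals below them:
  a vector of length \<open>n\<close> is a function of which only the values on \<open>{..<n}\<close> matter, and a matrix
  \<open>A\<close> is the function of rows \<open>\<lambda>l. A l\<close>. The sets of points below consist of extensional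
  functions, so that a vector corresponds to exactly one element.
\<close>

definition dot :: "nat \<Rightarrow> (nat \<Rightarrow> real) \<Rightarrow> (nat \<Rightarrow> real) \<Rightarrow> real" where
  "dot n u x = (\<Sum>i<n. u i * x i)"

definition maximum :: "('a \<Rightarrow> real) \<Rightarrow> 'a set \<Rightarrow> real" where
  "maximum g X = (GREATEST v. v \<in> g ` X)"


section \<open>Generalized Horn systems\<close>

text \<open>
  The inequality with coefficient vector \<open>r\<close> and right-hand side \<open>\<beta>\<close> is
  \<open>\<Sum>i. a i * x i - q * x j \<le> \<beta>\<close>. If \<open>q = 0\<close> there is no term \<open>x j\<close>, and no designated index is
  required. Otherwise a bound \<open>x i \<le> 1\<close> in dimension one, or a packing constraint involving all
  variables, would not be a generalized Horn constraint.
\<close>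

definition generalized_Horn ::
  "nat \<Rightarrow> (nat \<Rightarrow> int) \<Rightarrow> int \<Rightarrow> (nat \<Rightarrow> int) \<Rightarrow> int \<Rightarrow> nat \<Rightarrow> bool" where
  "generalized_Horn n r \<beta> a q j \<longleftrightarrow>
     (\<forall>i<n. 0 \<le> a i) \<and> 0 \<le> q \<and> 0 \<le> \<beta> \<and>
     (q \<noteq> 0 \<longrightarrow> j < n \<and> a j = 0) \<and>
     (\<forall>i<n. r i = a i - (if i = j then q else 0))"

definition slack_bounded_Horn_system ::
  "nat \<Rightarrow> nat \<Rightarrow> nat \<Rightarrow> (nat \<Rightarrow> nat \<Rightarrow> int) \<Rightarrow> (nat \<Rightarrow> int) \<Rightarrow> bool" where
  "slack_bounded_Horn_system k n m A b \<longleftrightarrow>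
     (\<forall>l<m. \<exists>a q j. generalized_Horn n (A l) (b l) a q j \<and> q \<le> int k * b l)"

definition contains_upper_bounds ::
  "nat \<Rightarrow> nat \<Rightarrow> (nat \<Rightarrow> nat \<Rightarrow> int) \<Rightarrow> (nat \<Rightarrow> int) \<Rightarrow> bool" where
  "contains_upper_bounds n m A b \<longleftrightarrow>
     (\<forall>i<n. \<exists>l<m. (\<forall>i'<n. A l i' = (if i' = i then 1 else 0)) \<and> b l = 1)"

definition satisfies_system ::
  "nat \<Rightarrow> nat \<Rightarrow> (nat \<Rightarrow> nat \<Rightarrow> int) \<Rightarrow> (nat \<Rightarrow> int) \<Rightarrow> (nat \<Rightarrow> real) \<Rightarrow> bool" where
  "satisfies_system n m A b x \<longleftrightarrow> (\<forall>l<m. dot n (\<lambda>i. real_of_int (A l i)) x \<le> real_of_int (b l))"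

definition integer_points ::
  "nat \<Rightarrow> nat \<Rightarrow> (nat \<Rightarrow> nat \<Rightarrow> int) \<Rightarrow> (nat \<Rightarrow> int) \<Rightarrow> (nat \<Rightarrow> real) set" where
  "integer_points n m A b = {x \<in> {..<n} \<rightarrow>\<^sub>E {0, 1}. satisfies_system n m A b x}"

definition horn_polytope ::
  "nat \<Rightarrow> nat \<Rightarrow> (nat \<Rightarrow> nat \<Rightarrow> int) \<Rightarrow> (nat \<Rightarrow> int) \<Rightarrow> (nat \<Rightarrow> real) set" where
  "horn_polytope n m A b = {x \<in> {..<n} \<rightarrow>\<^sub>E {0..1}. satisfies_system n m A b x}"


section \<open>Chvatal-Gomory cuts with restricted multipliers\<close>

definition Lam :: "nat \<Rightarrow> real set" where
  "Lam f = {0} \<union> {1 / real f..1}"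

text \<open>
  The multipliers \<open>w\<close> are those of the rows of the system, and \<open>\<mu> i\<close> is the multiplier of
  \<open>- x i \<le> 0\<close>; \<open>\<alpha> x \<le> \<beta>\<close> is the resulting cut.
\<close>

definition rank1_CG_cut ::
  "nat \<Rightarrow> nat \<Rightarrow> nat \<Rightarrow> (nat \<Rightarrow> nat \<Rightarrow> int) \<Rightarrow> (nat \<Rightarrow> int) \<Rightarrow> (nat \<Rightarrow> real) \<Rightarrow> int \<Rightarrow> bool" where
  "rank1_CG_cut f n m A b \<alpha> \<beta> \<longleftrightarrow>
     (\<exists>w \<mu>. (\<forall>l<m. w l \<in> Lam f) \<and> (\<forall>i<n. 0 \<le> \<mu> i) \<and>
        (\<forall>i<n. \<alpha> i = (\<Sum>l<m. w l * real_of_int (A l i)) - \<mu> i \<and> \<alpha> i \<in> \<int>) \<and>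
        \<beta> = \<lfloor>\<Sum>l<m. w l * real_of_int (b l)\<rfloor>)"

definition CG_closure ::
  "nat \<Rightarrow> nat \<Rightarrow> nat \<Rightarrow> (nat \<Rightarrow> nat \<Rightarrow> int) \<Rightarrow> (nat \<Rightarrow> int) \<Rightarrow> (nat \<Rightarrow> real) set" where
  "CG_closure f n m A b =
     {x \<in> horn_polytope n m A b. \<forall>\<alpha> \<beta>. rank1_CG_cut f n m A b \<alpha> \<beta> \<longrightarrow> dot n \<alpha> x \<le> real_of_int \<beta>}"


section \<open>Multilinear polynomials\<close>

text \<open>
  A multilinear polynomial is given by its coefficients: \<open>p S\<close> is the coefficient of the monomial
  \<open>\<Prod>i\<in>S. x i\<close>. Modulo \<open>x i ^ 2 = x i\<close> the product of the monomials of \<open>T\<close> and \<open>U\<close> is the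
  monomial of \<open>T \<union> U\<close>.
\<close>

type_synonym mlpoly = "nat set \<Rightarrow> real"

definition ml_polys :: "nat \<Rightarrow> nat \<Rightarrow> mlpoly set" where
  "ml_polys n d = {p. \<forall>S. p S \<noteq> 0 \<longrightarrow> S \<subseteq> {..<n} \<and> card S \<le> d}"

definition ml_mult :: "mlpoly \<Rightarrow> mlpoly \<Rightarrow> mlpoly" where
  "ml_mult p q = (\<lambda>S. \<Sum>(T, U) \<in> {(T, U). T \<union> U = S}. p T * q U)"

definition ml_one :: mlpoly where
  "ml_one = (\<lambda>S. if S = {} then 1 else 0)"

definition ml_var :: "nat \<Rightarrow> mlpoly" where
  "ml_var i = (\<lambda>S. if S = {i} then 1 else 0)"

definition ml_affine :: "nat \<Rightarrow> real \<Rightarrow> (nat \<Rightarrow> real) \<Rightarrow> mlpoly" where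
  "ml_affine n d u = (\<lambda>S. d * ml_one S + (\<Sum>i<n. u i * ml_var i S))"


section \<open>Sum-of-squares relaxation\<close>

definition sos_constraints ::
  "nat \<Rightarrow> nat \<Rightarrow> (nat \<Rightarrow> nat \<Rightarrow> int) \<Rightarrow> (nat \<Rightarrow> int) \<Rightarrow> mlpoly set" where
  "sos_constraints n m A b =
     {ml_affine n (real_of_int (b l)) (\<lambda>i. - real_of_int (A l i)) | l. l < m} \<union>
     {ml_var i | i. i < n} \<union>
     {(\<lambda>S. ml_one S - ml_var i S) | i. i < n}"

definition pseudo_expectation ::
  "nat \<Rightarrow> nat \<Rightarrow> nat \<Rightarrow> (nat \<Rightarrow> nat \<Rightarrow> int) \<Rightarrow> (nat \<Rightarrow> int) \<Rightarrow> (mlpoly \<Rightarrow> real) \<Rightarrow> bool" where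
  "pseudo_expectation t n m A b E \<longleftrightarrow>
     (\<forall>p\<in>ml_polys n (2 * t + 1). \<forall>q\<in>ml_polys n (2 * t + 1). E (\<lambda>S. p S + q S) = E p + E q) \<and>
     (\<forall>p\<in>ml_polys n (2 * t + 1). \<forall>s. E (\<lambda>S. s * p S) = s * E p) \<and>
     E ml_one = 1 \<and>
     (\<forall>p\<in>ml_polys n t. 0 \<le> E (ml_mult p p)) \<and>
     (\<forall>p\<in>ml_polys n t. \<forall>g\<in>sos_constraints n m A b. 0 \<le> E (ml_mult (ml_mult p p) g))"

definition sos_relaxation ::
  "nat \<Rightarrow> nat \<Rightarrow> nat \<Rightarrow> (nat \<Rightarrow> nat \<Rightarrow> int) \<Rightarrow> (nat \<Rightarrow> int) \<Rightarrow> (nat \<Rightarrow> real) set" where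
  "sos_relaxation t n m A b =
     {restrict (\<lambda>i. E (ml_var i)) {..<n} | E. pseudo_expectation t n m A b E}"


section \<open>Optimal values\<close>

definition OPT ::
  "nat \<Rightarrow> nat \<Rightarrow> (nat \<Rightarrow> nat \<Rightarrow> int) \<Rightarrow> (nat \<Rightarrow> int) \<Rightarrow> (nat \<Rightarrow> real) \<Rightarrow> real" where
  "OPT n m A b c = maximum (dot n c) (integer_points n m A b)"

definition OPT_CG ::
  "nat \<Rightarrow> nat \<Rightarrow> nat \<Rightarrow> (nat \<Rightarrow> nat \<Rightarrow> int) \<Rightarrow> (nat \<Rightarrow> int) \<Rightarrow> (nat \<Rightarrow> real) \<Rightarrow> real" where
  "OPT_CG f n m A b c = maximum (dot n c) (CG_closure f n m A b)"

definition OPT_SoS ::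
  "nat \<Rightarrow> nat \<Rightarrow> nat \<Rightarrow> (nat \<Rightarrow> nat \<Rightarrow> int) \<Rightarrow> (nat \<Rightarrow> int) \<Rightarrow> (nat \<Rightarrow> real) \<Rightarrow> real" where
  "OPT_SoS t n m A b c = maximum (dot n c) (sos_relaxation t n m A b)"

end

theory Submission
  imports Defs "HOL-Analysis.Function_Topology"
begin

text \<open>
  If \<open>x\<close> is a solution of the \<open>D\<close>-SoS relaxation, then \<open>x / (1 + \<epsilon>)\<close> lies in the CG closure. Write
  \<open>r\<close> for the unrounded right-hand side of a cut. Scaling alone repairs the cut when
  \<open>\<lfloor>r\<rfloor> \<ge> 1 / \<epsilon>\<close>. Otherwise \<open>r\<close> is small. Every row with a negative coefficient has a multiplier
  at least \<open>1 / f\<close> and \<open>q \<le> k b\<close>, \<open>b \<ge> 1\<close>, so the negative coefficients of the cut add up to at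
  most \<open>(k + f) r\<close>. Hence a monomial with more than \<open>K = (1 + 2 (k + f)) r\<close> variables in the support
  of the cut has pseudo-expectation zero. On this support the pseudo-expectation is therefore an
  expectation over genuine 0/1 points with at most \<open>K\<close> ones. The unrounded cut holds at
  each of these points, so it holds there after rounding, and so does its average over them.
\<close>

section \<open>Moebius inversion and pseudo-indicators\<close>

text \<open>In a Boolean interval with more than one element the sets of even and of odd size are
  equally many.\<close>

lemma alternating_sum_interval:
  assumes "finite V" "U \<subseteq> V"
  shows "(\<Sum>W\<in>{W\<in>Pow V. U \<subseteq> W}. (-1) ^ card W) = (if U = V then (-1) ^ card V else (0::real))"
proof (cases "U = V")
  case True
  then have "{W\<in>Pow V. U \<subseteq> W} = {V}" by auto
  then show ?thesis using True by simp
next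
  case False
  then have "U \<subset> V" using assms by auto
  note * = card_subsupersets_even_odd[OF assms(1) this]
  have "(\<Sum>W\<in>{W\<in>Pow V. U \<subseteq> W}. (-1) ^ card W) = (0::real)"
  proof (rule sum_alternating_cancels)
    show "card {W \<in> {W\<in>Pow V. U \<subseteq> W}. even (card W)} = card {W \<in> {W\<in>Pow V. U \<subseteq> W}. odd (card W)}"
      using * by (simp add: conj_ac)
  qed (use assms in auto)
  then show ?thesis using False by simp
qed

text \<open>Inclusion-exclusion: if \<open>y W\<close> is the probability that all coordinates in
  \<open>W\<close> are 1, this is the probability that \<open>U\<close> is exactly the set of ones
  within \<open>S\<close>. The sign is that of \<open>card (W - U)\<close>, written without a
  difference.\<close>

definition moebius :: "'a set \<Rightarrow> ('a set \<Rightarrow> real) \<Rightarrow> 'a set \<Rightarrow> real" where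
  "moebius S y U = (\<Sum>W\<in>{W\<in>Pow S. U \<subseteq> W}. (-1) ^ (card U + card W) * y W)"

text \<open>After swapping the two sums, the inner one alternates over the interval from
  \<open>W\<close> to \<open>V\<close> and cancels unless \<open>V = W\<close>.\<close>

lemma moebius_inversion:
  assumes "finite S" "W \<subseteq> S"
  shows "(\<Sum>U\<in>{U\<in>Pow S. W \<subseteq> U}. moebius S y U) = y W"
proof -
  have "(\<Sum>U\<in>{U\<in>Pow S. W \<subseteq> U}. moebius S y U)
      = (\<Sum>U\<in>{U\<in>Pow S. W \<subseteq> U}. \<Sum>V\<in>{V\<in>{V\<in>Pow S. W \<subseteq> V}. U \<subseteq> V}. (-1) ^ (card U + card V) * y V)"
    unfolding moebius_def by (intro sum.cong) auto
  also have "\<dots> = (\<Sum>V\<in>{V\<in>Pow S. W \<subseteq> V}. \<Sum>U\<in>{U\<in>{U\<in>Pow S. W \<subseteq> U}. U \<subseteq> V}. (-1) ^ (card U + card V) * y V)"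
    using assms by (intro sum.swap_restrict) auto
  also have "\<dots> = (\<Sum>V\<in>{V\<in>Pow S. W \<subseteq> V}. (-1) ^ card V * y V * (\<Sum>U\<in>{U\<in>Pow V. W \<subseteq> U}. (-1) ^ card U))"
    unfolding sum_distrib_left
    by (intro sum.cong refl) (auto simp: power_add)
  also have "\<dots> = (\<Sum>V\<in>{V\<in>Pow S. W \<subseteq> V}. if W = V then y V else 0)"
  proof (intro sum.cong refl)
    fix V assume "V \<in> {V\<in>Pow S. W \<subseteq> V}"
    then have "finite V" "W \<subseteq> V" using assms finite_subset by auto
    from alternating_sum_interval[OF this]
    show "(-1) ^ card V * y V * (\<Sum>U\<in>{U\<in>Pow V. W \<subseteq> U}. (-1) ^ card U) = (if W = V then y V else 0)"
      by (auto simp flip: power_add)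
  qed
  also have "\<dots> = y W" using assms by (subst sum.delta') auto
  finally show ?thesis .
qed

lemma moebius_truncated:
  assumes "finite S" "K < card U"
  shows "moebius S (\<lambda>W. if card W \<le> K then y W else 0) U = 0"
  unfolding moebius_def
proof (intro sum.neutral ballI)
  fix W assume "W \<in> {W \<in> Pow S. U \<subseteq> W}"
  then have "finite W" "U \<subseteq> W" using assms finite_subset by auto
  then have "card U \<le> card W" by (rule card_mono)
  then show "(- 1) ^ (card U + card W) * (if card W \<le> K then y W else 0) = 0"
    using assms by auto
qed

text \<open>
  If \<open>y S\<close> is the pseudo-expectation of the monomial of \<open>S\<close>, then \<open>quad n y p W\<close> is that of \<open>p\<^sup>2\<close> times
  the monomial of \<open>W\<close>.
\<close>

definition quad :: "nat \<Rightarrow> (nat set \<Rightarrow> real) \<Rightarrow> mlpoly \<Rightarrow> nat set \<Rightarrow> real" where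
  "quad n y p W = (\<Sum>T\<in>Pow {..<n}. \<Sum>U\<in>Pow {..<n}. p T * p U * y (T \<union> U \<union> W))"

text \<open>
  The indicator polynomial of the point \<open>1\<^sub>U\<close>, cut off at degree \<open>K\<close>; on points with at most \<open>K\<close> ones
  it is still the indicator.
\<close>

definition ind_poly :: "nat \<Rightarrow> nat set \<Rightarrow> nat set \<Rightarrow> mlpoly" where
  "ind_poly K S U = (\<lambda>W. if U \<subseteq> W \<and> W \<subseteq> S \<and> card W \<le> K then (-1) ^ (card U + card W) else 0)"

text \<open>Only monomials \<open>W\<close> inside \<open>V\<close> contribute, and these have at
  most \<open>K\<close> elements, so the truncation is not felt.\<close>

lemma ind_poly_eval:
  assumes "finite S" "U \<subseteq> S" "V \<subseteq> S" "card V \<le> K"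
  shows "(\<Sum>W\<in>Pow S. ind_poly K S U W * of_bool (W \<subseteq> V)) = of_bool (V = U)"
proof -
  have fV: "finite V" using assms finite_subset by blast
  have "(\<Sum>W\<in>Pow S. ind_poly K S U W * of_bool (W \<subseteq> V))
      = (\<Sum>W\<in>{W\<in>Pow V. U \<subseteq> W}. (-1) ^ card U * (-1) ^ card W)"
  proof (rule sum.mono_neutral_cong_right)
    show "ind_poly K S U W * of_bool (W \<subseteq> V) = (- 1) ^ card U * (- 1) ^ card W"
      if "W \<in> {W\<in>Pow V. U \<subseteq> W}" for W
      using that assms card_mono[OF fV, of W] by (auto simp: ind_poly_def power_add)
  qed (use assms in \<open>auto simp: ind_poly_def\<close>)
  also have "\<dots> = (-1) ^ card U * (\<Sum>W\<in>{W\<in>Pow V. U \<subseteq> W}. (-1) ^ card W)"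
    by (simp add: sum_distrib_left)
  also have "\<dots> = of_bool (V = U)"
  proof (cases "U \<subseteq> V")
    case True
    show ?thesis unfolding alternating_sum_interval[OF fV True] by (auto simp flip: power_add)
  next
    case False
    then have *: "{W\<in>Pow V. U \<subseteq> W} = {}" and "V \<noteq> U" by auto
    show ?thesis unfolding * using \<open>V \<noteq> U\<close> by simp
  qed
  finally show ?thesis .
qed

text \<open>By \<open>vanish\<close>, \<open>y\<close> agrees with its truncation on all sets that
  occur. Inversion then turns \<open>quad\<close> into a sum over points \<open>Q\<close> of
  \<open>z Q\<close> times the squared value of the indicator at \<open>Q\<close>, and only
  \<open>Q = U\<close> survives.\<close>

lemma quad_ind_poly:
  assumes S: "S \<subseteq> {..<n}" and U: "U \<subseteq> S" and cU: "card U \<le> K" and V: "V \<subseteq> S" "card V \<le> 1"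
    and vanish: "\<And>W. W \<subseteq> S \<Longrightarrow> K < card W \<Longrightarrow> card W \<le> 2 * K + 1 \<Longrightarrow> y W = 0"
  defines "z \<equiv> moebius S (\<lambda>W. if card W \<le> K then y W else 0)"
  shows "quad n y (ind_poly K S U) V = of_bool (V \<subseteq> U) * z U"
proof -
  have fS: "finite S" using S finite_subset by blast
  define p where "p = ind_poly K S U"
  \<comment> \<open>\<open>c Q\<close> is the value of \<open>p\<close> at the 0/1 point with set of
    ones \<open>Q\<close>.\<close>
  define c where "c = (\<lambda>V. \<Sum>W\<in>Pow S. p W * of_bool (W \<subseteq> V))"
  have p0: "p W = 0" if "\<not> (W \<subseteq> S \<and> card W \<le> K)" for W
    using that by (auto simp: p_def ind_poly_def)
  have yz: "p T * p W * y (T \<union> W \<union> V) =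
      (\<Sum>Q\<in>Pow S. z Q * of_bool (V \<subseteq> Q) * (p T * of_bool (T \<subseteq> Q)) * (p W * of_bool (W \<subseteq> Q)))"
    if "T \<subseteq> S" "W \<subseteq> S" for T W
  proof (cases "card T \<le> K \<and> card W \<le> K")
    case True
    \<comment> \<open>Two factors of degree at most \<open>K\<close> and one of degree at most 1:
      this is why \<open>vanish\<close> has to reach up to size \<open>2 * K + 1\<close>.\<close>
    have "card (T \<union> W \<union> V) \<le> card T + card W + card V"
      by (meson add_le_mono card_Un_le order.refl order_trans)
    then have "card (T \<union> W \<union> V) \<le> 2 * K + 1" using True V by linarith
    then have "y (T \<union> W \<union> V) = (if card (T \<union> W \<union> V) \<le> K then y (T \<union> W \<union> V) else 0)"
      using vanish[of "T \<union> W \<union> V"] that V by auto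
    also have "\<dots> = (\<Sum>Q\<in>{Q\<in>Pow S. T \<union> W \<union> V \<subseteq> Q}. z Q)"
      unfolding z_def by (subst moebius_inversion) (use fS that V in auto)
    finally have *: "y (T \<union> W \<union> V) = (\<Sum>Q\<in>{Q\<in>Pow S. T \<union> W \<union> V \<subseteq> Q}. z Q)" .
    show ?thesis unfolding * sum_distrib_left
      by (rule sum.mono_neutral_cong_left) (use fS in auto)
  next
    case False
    then have "p T = 0 \<or> p W = 0" using p0 by auto
    then show ?thesis by auto
  qed
  have "quad n y p V = (\<Sum>T\<in>Pow S. \<Sum>W\<in>Pow S. p T * p W * y (T \<union> W \<union> V))"
    unfolding quad_def
    by (intro sum.mono_neutral_cong_right) (use S p0 in \<open>auto intro!: sum.neutral\<close>)
  also have "\<dots> = (\<Sum>T\<in>Pow S. \<Sum>W\<in>Pow S. \<Sum>Q\<in>Pow S. z Q * of_bool (V \<subseteq> Q) * (p T * of_bool (T \<subseteq> Q)) * (p W * of_bool (W \<subseteq> Q)))"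
    by (intro sum.cong refl yz) auto
  also have "\<dots> = (\<Sum>T\<in>Pow S. \<Sum>Q\<in>Pow S. (\<Sum>W\<in>Pow S. z Q * of_bool (V \<subseteq> Q) * (p T * of_bool (T \<subseteq> Q)) * (p W * of_bool (W \<subseteq> Q))))"
    by (intro sum.cong refl sum.swap)
  also have "\<dots> = (\<Sum>Q\<in>Pow S. \<Sum>T\<in>Pow S. (\<Sum>W\<in>Pow S. z Q * of_bool (V \<subseteq> Q) * (p T * of_bool (T \<subseteq> Q)) * (p W * of_bool (W \<subseteq> Q))))"
    by (rule sum.swap)
  also have "\<dots> = (\<Sum>Q\<in>Pow S. z Q * of_bool (V \<subseteq> Q) * (c Q * c Q))"
    by (simp only: c_def sum_product) (simp add: sum_distrib_left mult.assoc)
  also have "\<dots> = (\<Sum>Q\<in>Pow S. if Q = U then of_bool (V \<subseteq> U) * z U else 0)"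
  proof (intro sum.cong refl)
    fix Q assume Q: "Q \<in> Pow S"
    show "z Q * of_bool (V \<subseteq> Q) * (c Q * c Q) = (if Q = U then of_bool (V \<subseteq> U) * z U else 0)"
    proof (cases "card Q \<le> K")
      case True
      then have "c Q = of_bool (Q = U)"
        unfolding c_def p_def using ind_poly_eval[OF fS U, of Q K] Q by auto
      then show ?thesis by auto
    next
      case False
      then show ?thesis
        using cU moebius_truncated[OF fS, of K Q y] by (auto simp: z_def)
    qed
  qed
  also have "\<dots> = of_bool (V \<subseteq> U) * z U" using fS U by simp
  finally show ?thesis unfolding p_def .
qed


section \<open>Moment sequences\<close>

text \<open>The conditions on a pseudo-expectation, expressed through its values on monomials;
  \<open>moments_iff\<close> makes this precise.\<close>

definition moments ::
  "nat \<Rightarrow> nat \<Rightarrow> nat \<Rightarrow> (nat \<Rightarrow> nat \<Rightarrow> int) \<Rightarrow> (nat \<Rightarrow> int) \<Rightarrow> (nat set \<Rightarrow> real) \<Rightarrow> bool" where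
  "moments t n m A b y \<longleftrightarrow> y {} = 1 \<and>
     (\<forall>p\<in>ml_polys n t. 0 \<le> quad n y p {} \<and>
        (\<forall>i<n. 0 \<le> quad n y p {i} \<and> quad n y p {i} \<le> quad n y p {}) \<and>
        (\<forall>l<m. (\<Sum>i<n. real_of_int (A l i) * quad n y p {i}) \<le> real_of_int (b l) * quad n y p {}))"

lemma ind_poly_in_ml_polys:
  assumes "S \<subseteq> {..<n}" "K \<le> t"
  shows "ind_poly K S U \<in> ml_polys n t"
  using assms by (auto simp: ind_poly_def ml_polys_def)

text \<open>
  The Moebius transform \<open>z\<close> of \<open>y\<close> on \<open>S\<close> is a probability distribution on the subsets of \<open>S\<close>, and
  testing \<open>valid\<close> with the indicator of \<open>U\<close> shows that \<open>\<alpha>\<close> is at most \<open>r\<close> wherever \<open>z U > 0\<close>.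
\<close>

lemma moments_integer_valued:
  fixes \<alpha> :: "nat \<Rightarrow> int"
  assumes mom: "moments t n m A b y" and S: "S \<subseteq> {..<n}" and K: "K \<le> t"
    and vanish: "\<And>W. W \<subseteq> S \<Longrightarrow> K < card W \<Longrightarrow> card W \<le> 2 * K + 1 \<Longrightarrow> y W = 0"
    and supp: "\<And>i. i < n \<Longrightarrow> i \<notin> S \<Longrightarrow> \<alpha> i = 0"
    and valid: "\<And>p. p \<in> ml_polys n t \<Longrightarrow>
      (\<Sum>i<n. real_of_int (\<alpha> i) * quad n y p {i}) \<le> r * quad n y p {}"
  shows "(\<Sum>i<n. real_of_int (\<alpha> i) * y {i}) \<le> real_of_int \<lfloor>r\<rfloor>"
proof -
  have fS: "finite S" using S finite_subset by blast
  define y' where "y' = (\<lambda>W. if card W \<le> K then y W else 0)"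
  define z where "z = moebius S y'"
  define \<beta> where "\<beta> U = (\<Sum>i<n. real_of_int (\<alpha> i) * of_bool (i \<in> U))" for U
  have qz: "quad n y (ind_poly K S U) V = of_bool (V \<subseteq> U) * z U"
    if "U \<subseteq> S" "card U \<le> K" "V \<subseteq> S" "card V \<le> 1" for U V
    unfolding z_def y'_def by (rule quad_ind_poly) (use that S vanish in auto)
  have z: "z U * \<beta> U \<le> z U * real_of_int \<lfloor>r\<rfloor>" if U: "U \<subseteq> S" for U
  proof (cases "card U \<le> K")
    case True
    let ?p = "ind_poly K S U"
    have p: "?p \<in> ml_polys n t" using S K by (rule ind_poly_in_ml_polys)
    have q0: "quad n y ?p {} = z U" using qz[OF U True, of "{}"] by simp
    have z0: "0 \<le> z U" using mom p q0 by (auto simp: moments_def)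
    have "z U * \<beta> U = (\<Sum>i<n. real_of_int (\<alpha> i) * quad n y ?p {i})"
      unfolding \<beta>_def sum_distrib_left
    proof (intro sum.cong refl)
      fix i assume "i \<in> {..<n}"
      then show "z U * (real_of_int (\<alpha> i) * of_bool (i \<in> U)) = real_of_int (\<alpha> i) * quad n y ?p {i}"
        using supp[of i] qz[OF U True, of "{i}"] by (cases "i \<in> S") auto
    qed
    also have "\<dots> \<le> r * z U" using valid[OF p] q0 by simp
    finally have *: "z U * \<beta> U \<le> r * z U" .
    show ?thesis
    proof (cases "z U = 0")
      case False
      then have "\<beta> U \<le> r" using * z0 by (simp add: mult.commute)
      \<comment> \<open>Integrality of \<alpha> makes the value at each point an integer, so the
        bound \<open>r\<close> can be rounded down pointwise.\<close>
      moreover have "\<beta> U = real_of_int (\<Sum>i<n. \<alpha> i * of_bool (i \<in> U))"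
        by (simp add: \<beta>_def)
      ultimately have "\<beta> U \<le> real_of_int \<lfloor>r\<rfloor>" by (simp add: le_floor_iff del: of_int_sum)
      then show ?thesis using z0 by (rule mult_left_mono)
    qed auto
  next
    case False
    then show ?thesis using moebius_truncated[OF fS, of K U y] by (simp add: z_def y'_def)
  qed
  have y_z: "y V = (\<Sum>U\<in>Pow S. z U * of_bool (V \<subseteq> U))" if "V \<subseteq> S" "card V \<le> 1" for V
  proof -
    \<comment> \<open>If \<open>K = 0\<close>, a singleton already lies above the truncation;
      \<open>vanish\<close> covers this case because \<open>1 \<le> 2 * K + 1\<close>.\<close>
    have "y V = y' V" using vanish[of V] that by (auto simp: y'_def)
    also have "\<dots> = (\<Sum>U\<in>{U\<in>Pow S. V \<subseteq> U}. z U)"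
      unfolding z_def using moebius_inversion[OF fS that(1)] by simp
    also have "\<dots> = (\<Sum>U\<in>Pow S. z U * of_bool (V \<subseteq> U))"
      by (rule sum.mono_neutral_cong_left) (use fS in auto)
    finally show ?thesis .
  qed
  have "(\<Sum>i<n. real_of_int (\<alpha> i) * y {i})
      = (\<Sum>i<n. \<Sum>U\<in>Pow S. real_of_int (\<alpha> i) * (z U * of_bool (i \<in> U)))"
  proof (intro sum.cong refl)
    fix i assume "i \<in> {..<n}"
    then show "real_of_int (\<alpha> i) * y {i} = (\<Sum>U\<in>Pow S. real_of_int (\<alpha> i) * (z U * of_bool (i \<in> U)))"
      using supp[of i] y_z[of "{i}"] by (cases "i \<in> S") (auto simp: sum_distrib_left)
  qed
  also have "\<dots> = (\<Sum>U\<in>Pow S. \<Sum>i<n. real_of_int (\<alpha> i) * (z U * of_bool (i \<in> U)))"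
    by (rule sum.swap)
  also have "\<dots> = (\<Sum>U\<in>Pow S. z U * \<beta> U)"
    unfolding \<beta>_def sum_distrib_left by (intro sum.cong refl) (simp add: mult_ac)
  also have "\<dots> \<le> (\<Sum>U\<in>Pow S. z U * real_of_int \<lfloor>r\<rfloor>)" by (intro sum_mono z) auto
  also have "\<dots> = real_of_int \<lfloor>r\<rfloor>"
    using y_z[of "{}"] mom by (simp add: moments_def flip: sum_distrib_right)
  finally show ?thesis .
qed

section \<open>Monomials as test polynomials\<close>

definition ml_mono :: "nat set \<Rightarrow> mlpoly" where
  "ml_mono S = (\<lambda>T. if T = S then 1 else 0)"

lemma ml_one_eq_mono: "ml_one = ml_mono {}" by (simp add: ml_one_def ml_mono_def)

lemma ml_var_eq_mono: "ml_var i = ml_mono {i}" by (simp add: ml_var_def ml_mono_def)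

lemma ml_mono_in_ml_polys: "S \<subseteq> {..<n} \<Longrightarrow> card S \<le> d \<Longrightarrow> ml_mono S \<in> ml_polys n d"
  by (auto simp: ml_mono_def ml_polys_def)

lemma quad_two_monos:
  assumes "U \<subseteq> {..<n}" "V \<subseteq> {..<n}"
  shows "quad n y (\<lambda>T. ml_mono U T + s * ml_mono V T) W
    = y (U \<union> W) + 2 * s * y (U \<union> V \<union> W) + s\<^sup>2 * y (V \<union> W)"
proof -
  have *: "(\<Sum>T\<in>Pow {..<n}. ml_mono Q T * h T) = h Q" if "Q \<subseteq> {..<n}" for Q and h :: "nat set \<Rightarrow> real"
    using that by (simp add: ml_mono_def if_distrib[of "\<lambda>x. x * _"] cong: if_cong)
  let ?p = "\<lambda>T. ml_mono U T + s * ml_mono V T"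
  have **: "(\<Sum>T\<in>Pow {..<n}. ?p T * h T) = h U + s * h V" for h
    using *[OF assms(1), of h] *[OF assms(2), of h]
    by (simp add: distrib_right sum.distrib mult.assoc flip: sum_distrib_left)
  have "quad n y ?p W = (\<Sum>T\<in>Pow {..<n}. ?p T * (\<Sum>Q\<in>Pow {..<n}. ?p Q * y (T \<union> Q \<union> W)))"
    unfolding quad_def by (simp add: sum_distrib_left mult.assoc)
  also have "\<dots> = y (U \<union> W) + s * y (U \<union> V \<union> W) + s * (y (V \<union> U \<union> W) + s * y (V \<union> W))"
    unfolding ** by simp
  finally show ?thesis by (simp add: Un_commute[of V U] algebra_simps power2_eq_square)
qed

lemma quad_mono:
  assumes "U \<subseteq> {..<n}"
  shows "quad n y (ml_mono U) W = y (U \<union> W)"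
  using quad_two_monos[OF assms assms, of y 0 W] by simp

section \<open>Pseudo-expectations and moment sequences\<close>

definition lin :: "nat \<Rightarrow> (nat set \<Rightarrow> real) \<Rightarrow> mlpoly \<Rightarrow> real" where
  "lin n y p = (\<Sum>S\<in>Pow {..<n}. p S * y S)"

text \<open>The pairs \<open>(T, U)\<close> are grouped by their union, which is how
  \<open>ml_mult\<close> collects coefficients.\<close>

lemma lin_ml_mult:
  "lin n y (ml_mult p q) = (\<Sum>T\<in>Pow {..<n}. \<Sum>U\<in>Pow {..<n}. p T * q U * y (T \<union> U))"
proof -
  let ?P = "Pow {..<n} \<times> Pow {..<n}"
  have "lin n y (ml_mult p q) = (\<Sum>S\<in>Pow {..<n}. \<Sum>x\<in>{x\<in>?P. fst x \<union> snd x = S}. p (fst x) * q (snd x) * y (fst x \<union> snd x))"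
    unfolding lin_def ml_mult_def sum_distrib_right
    by (intro sum.cong refl) auto
  also have "\<dots> = (\<Sum>x\<in>?P. p (fst x) * q (snd x) * y (fst x \<union> snd x))"
    by (rule sum.group) auto
  also have "\<dots> = (\<Sum>T\<in>Pow {..<n}. \<Sum>U\<in>Pow {..<n}. p T * q U * y (T \<union> U))"
    by (simp add: sum.cartesian_product case_prod_beta)
  finally show ?thesis .
qed

lemma lin_square: "lin n y (ml_mult p p) = quad n y p {}"
  by (simp add: lin_ml_mult quad_def)

text \<open>Multiplication by the square of \<open>p\<close> replaces the sequence \<open>y\<close>
  by the localized sequence \<open>quad n y p\<close>, so conditions on products become conditions
  on a linear functional of \<open>g\<close>.\<close>

lemma lin_square_mult: "lin n y (ml_mult (ml_mult p p) g) = lin n (quad n y p) g"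
proof -
  have "lin n y (ml_mult (ml_mult p p) g)
      = (\<Sum>V\<in>Pow {..<n}. g V * lin n (\<lambda>S. y (S \<union> V)) (ml_mult p p))"
    unfolding lin_ml_mult[of n y "ml_mult p p"] by (subst sum.swap) (simp add: lin_def sum_distrib_left mult_ac)
  also have "\<dots> = (\<Sum>V\<in>Pow {..<n}. g V * quad n y p V)"
    by (simp add: lin_ml_mult quad_def)
  finally show ?thesis by (simp only: lin_def)
qed

lemma lin_mono: "S \<subseteq> {..<n} \<Longrightarrow> lin n y (ml_mono S) = y S"
  by (simp add: lin_def ml_mono_def if_distrib[of "\<lambda>x. x * _"] cong: if_cong)

lemma lin_add: "lin n y (\<lambda>S. p S + q S) = lin n y p + lin n y q"
  by (simp add: lin_def distrib_right sum.distrib)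

lemma lin_scale: "lin n y (\<lambda>S. s * p S) = s * lin n y p"
  by (simp add: lin_def sum_distrib_left mult.assoc)

lemma lin_diff: "lin n y (\<lambda>S. p S - q S) = lin n y p - lin n y q"
  by (simp add: lin_def left_diff_distrib sum_subtractf)

lemma lin_affine: "lin n y (ml_affine n d u) = d * y {} + (\<Sum>i<n. u i * y {i})"
proof -
  have "lin n y (\<lambda>S. \<Sum>i<n. u i * ml_var i S) = (\<Sum>i<n. lin n y (\<lambda>S. u i * ml_var i S))"
    unfolding lin_def sum_distrib_right by (rule sum.swap)
  also have "\<dots> = (\<Sum>i<n. u i * y {i})"
    by (intro sum.cong refl) (simp add: lin_scale ml_var_eq_mono lin_mono)
  finally show ?thesis
    by (simp add: ml_affine_def lin_add lin_scale ml_one_eq_mono lin_mono)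
qed

lemma moments_iff:
  "moments t n m A b y \<longleftrightarrow> y {} = 1 \<and>
    (\<forall>p\<in>ml_polys n t. 0 \<le> lin n y (ml_mult p p) \<and>
      (\<forall>g\<in>sos_constraints n m A b. 0 \<le> lin n y (ml_mult (ml_mult p p) g)))"
proof -
  \<comment> \<open>This is applied to \<open>z = quad n y p\<close>. The constraints are affine, so
    only \<open>z {}\<close> and the values \<open>z {i}\<close> occur.\<close>
  have "(\<forall>g\<in>sos_constraints n m A b. 0 \<le> lin n z g) \<longleftrightarrow>
    (\<forall>i<n. 0 \<le> z {i} \<and> z {i} \<le> z {}) \<and>
    (\<forall>l<m. (\<Sum>i<n. real_of_int (A l i) * z {i}) \<le> real_of_int (b l) * z {})" for z
  proof -
    have "(\<forall>g\<in>sos_constraints n m A b. 0 \<le> lin n z g) \<longleftrightarrow>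
      (\<forall>l<m. 0 \<le> lin n z (ml_affine n (real_of_int (b l)) (\<lambda>i. - real_of_int (A l i)))) \<and>
      (\<forall>i<n. 0 \<le> lin n z (ml_var i)) \<and> (\<forall>i<n. 0 \<le> lin n z (\<lambda>S. ml_one S - ml_var i S))"
      unfolding sos_constraints_def by blast
    then show ?thesis
      by (auto simp: lin_affine lin_diff ml_one_eq_mono ml_var_eq_mono lin_mono sum_negf)
  qed
  then show ?thesis
    unfolding moments_def lin_square lin_square_mult by blast
qed

lemma ml_mult_in_ml_polys:
  assumes "p \<in> ml_polys n d" "q \<in> ml_polys n e"
  shows "ml_mult p q \<in> ml_polys n (d + e)"
  unfolding ml_polys_def
proof (intro CollectI allI impI)
  fix S assume "ml_mult p q S \<noteq> 0"
  then obtain x where x: "x \<in> {(T, U). T \<union> U = S}" "(case x of (T, U) \<Rightarrow> p T * q U) \<noteq> 0"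
    unfolding ml_mult_def by (rule sum.not_neutral_contains_not_neutral)
  then obtain T U where "T \<union> U = S" "p T \<noteq> 0" "q U \<noteq> 0" by auto
  then show "S \<subseteq> {..<n} \<and> card S \<le> d + e"
    using assms card_Un_le[of T U] by (fastforce simp: ml_polys_def)
qed

lemma sos_constraints_degree: "sos_constraints n m A b \<subseteq> ml_polys n 1"
proof
  fix g assume g: "g \<in> sos_constraints n m A b"
  show "g \<in> ml_polys n 1"
    unfolding ml_polys_def
  proof (intro CollectI allI impI)
    fix S assume "g S \<noteq> 0"
    moreover have "S = {} \<or> (\<exists>i<n. S = {i}) \<or> (\<Sum>i<n. u i * ml_var i S) = 0" for u
      by (auto simp: ml_var_def intro!: sum.neutral)
    moreover have "(\<exists>d u. g = ml_affine n d u) \<or> (\<exists>i<n. g = ml_var i)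
        \<or> (\<exists>i<n. g = (\<lambda>S. ml_one S - ml_var i S))"
      using g unfolding sos_constraints_def by blast
    ultimately have "S = {} \<or> (\<exists>i<n. S = {i})"
      by (auto simp: ml_affine_def ml_one_def ml_var_eq_mono ml_mono_def split: if_splits)
    then show "S \<subseteq> {..<n} \<and> card S \<le> 1" by auto
  qed
qed

text \<open>\<open>E\<close> is known to be linear only up to degree \<open>2 * t + 1\<close>, so
  \<open>p\<close> is assembled monomial by monomial and every partial sum is shown to stay within
  that degree.\<close>

lemma pseudo_expectation_lin:
  assumes E: "pseudo_expectation t n m A b E" and p: "p \<in> ml_polys n (2 * t + 1)"
  shows "E p = lin n (\<lambda>S. E (ml_mono S)) p"
proof -
  let ?P = "ml_polys n (2 * t + 1)"
  have add: "E (\<lambda>S. p S + q S) = E p + E q" if "p \<in> ?P" "q \<in> ?P" for p q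
    using E that by (simp add: pseudo_expectation_def)
  have scale: "E (\<lambda>S. s * p S) = s * E p" if "p \<in> ?P" for p s
    using E that by (simp add: pseudo_expectation_def)
  define F where "F = {S\<in>Pow {..<n}. card S \<le> 2 * t + 1}"
  have fF: "finite F" by (simp add: F_def)
  have mono: "ml_mono S \<in> ?P" if "S \<in> F" for S
    using that by (intro ml_mono_in_ml_polys) (auto simp: F_def)
  have "G \<subseteq> F \<Longrightarrow> E (\<lambda>T. \<Sum>S\<in>G. p S * ml_mono S T) = (\<Sum>S\<in>G. p S * E (ml_mono S))"
    if "finite G" for G
    using that
  proof (induction G)
    case empty
    \<comment> \<open>That \<open>E\<close> vanishes on the zero polynomial comes from scaling
      \<open>p\<close> by 0.\<close>
    have "E (\<lambda>T. 0 * p T) = 0 * E p" using p by (rule scale)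
    then show ?case by simp
  next
    case (insert S G)
    have S: "ml_mono S \<in> ?P" using insert.prems mono by auto
    have "(\<lambda>T. p S * ml_mono S T) \<in> ?P" using S by (auto simp: ml_polys_def)
    moreover have "(\<lambda>T. \<Sum>S\<in>G. p S * ml_mono S T) \<in> ?P"
      unfolding ml_polys_def
    proof (intro CollectI allI impI)
      fix T assume "(\<Sum>S\<in>G. p S * ml_mono S T) \<noteq> 0"
      then obtain Q where "Q \<in> G" "p Q * ml_mono Q T \<noteq> 0"
        by (rule sum.not_neutral_contains_not_neutral)
      then show "T \<subseteq> {..<n} \<and> card T \<le> 2 * t + 1"
        using insert.prems by (auto simp: ml_mono_def F_def split: if_splits)
    qed
    ultimately show ?case
      using insert S by (simp add: add scale)
  qed
  from this[OF fF] have *: "E (\<lambda>T. \<Sum>S\<in>F. p S * ml_mono S T) = (\<Sum>S\<in>F. p S * E (ml_mono S))"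
    by simp
  have pF: "p T = 0" if "T \<notin> F" for T using p that by (auto simp: ml_polys_def F_def)
  have "(\<Sum>S\<in>F. p S * ml_mono S T) = (\<Sum>S\<in>F. if S = T then p T else 0)" for T
    by (intro sum.cong refl) (auto simp: ml_mono_def)
  then have "(\<lambda>T. \<Sum>S\<in>F. p S * ml_mono S T) = p"
    using fF pF by auto
  moreover have "(\<Sum>S\<in>F. p S * E (ml_mono S)) = lin n (\<lambda>S. E (ml_mono S)) p"
    unfolding lin_def
    by (rule sum.mono_neutral_left) (use pF in \<open>auto simp: F_def\<close>)
  ultimately show ?thesis using * by simp
qed

text \<open>A square of degree \<open>2 * t\<close> times an affine constraint has degree at most
  \<open>2 * t + 1\<close>, exactly the range in which \<open>E\<close> is determined by its
  moments.\<close>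

lemma pseudo_expectation_moments:
  assumes E: "pseudo_expectation t n m A b E"
  shows "moments t n m A b (\<lambda>S. E (ml_mono S))"
proof -
  let ?y = "\<lambda>S. E (ml_mono S)"
  have "0 \<le> lin n ?y (ml_mult p p)" if p: "p \<in> ml_polys n t" for p
  proof -
    have "ml_mult p p \<in> ml_polys n (2 * t + 1)"
      using ml_mult_in_ml_polys[OF p p] by (fastforce simp: ml_polys_def)
    from pseudo_expectation_lin[OF E this] show ?thesis
      using E p unfolding pseudo_expectation_def by metis
  qed
  moreover have "0 \<le> lin n ?y (ml_mult (ml_mult p p) g)"
    if p: "p \<in> ml_polys n t" and g: "g \<in> sos_constraints n m A b" for p g
  proof -
    have "ml_mult (ml_mult p p) g \<in> ml_polys n (2 * t + 1)"
      using ml_mult_in_ml_polys[OF ml_mult_in_ml_polys[OF p p], of g 1] g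
        sos_constraints_degree[of n m A b] unfolding mult_2 by blast
    from pseudo_expectation_lin[OF E this] show ?thesis
      using E p g unfolding pseudo_expectation_def by metis
  qed
  moreover have "?y {} = 1" using E by (simp add: pseudo_expectation_def ml_one_eq_mono)
  ultimately show ?thesis unfolding moments_iff by blast
qed

lemma moments_pseudo_expectation:
  assumes "moments t n m A b y"
  shows "pseudo_expectation t n m A b (lin n y)"
  using assms unfolding moments_iff pseudo_expectation_def
  by (simp add: lin_add lin_scale ml_one_eq_mono lin_mono)

text \<open>Real sequences indexed by sets replace functionals on polynomials, which gives access to
  the product topology.\<close>

lemma sos_relaxation_moments:
  "sos_relaxation t n m A b = {restrict (\<lambda>i. y {i}) {..<n} | y. moments t n m A b y}"
proof (intro equalityI subsetI)
  fix x assume "x \<in> sos_relaxation t n m A b"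
  then obtain E where "pseudo_expectation t n m A b E" "x = restrict (\<lambda>i. E (ml_var i)) {..<n}"
    by (auto simp: sos_relaxation_def)
  then show "x \<in> {restrict (\<lambda>i. y {i}) {..<n} | y. moments t n m A b y}"
    unfolding ml_var_eq_mono by (auto dest: pseudo_expectation_moments)
next
  fix x assume "x \<in> {restrict (\<lambda>i. y {i}) {..<n} | y. moments t n m A b y}"
  then obtain y where y: "moments t n m A b y" "x = restrict (\<lambda>i. y {i}) {..<n}" by blast
  have "x = restrict (\<lambda>i. lin n y (ml_var i)) {..<n}"
    unfolding y(2) by (intro restrict_ext) (simp add: ml_var_eq_mono lin_mono)
  then show "x \<in> sos_relaxation t n m A b"
    using moments_pseudo_expectation[OF y(1)] unfolding sos_relaxation_def by blast
qed


section \<open>Attainment of the optima\<close>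

text \<open>Two test monomials of size at most \<open>t\<close> and one variable have a union of
  size at most \<open>2 * t + 1\<close>.\<close>

lemma moments_cong:
  assumes eq: "\<And>S. S \<subseteq> {..<n} \<Longrightarrow> card S \<le> 2 * t + 1 \<Longrightarrow> y S = z S"
  shows "moments t n m A b y \<longleftrightarrow> moments t n m A b z"
proof -
  have quad: "quad n y p W = quad n z p W"
    if p: "p \<in> ml_polys n t" and W: "W \<subseteq> {..<n}" "card W \<le> 1" for p W
    unfolding quad_def
  proof (intro sum.cong refl)
    fix T U assume TU: "T \<in> Pow {..<n}" "U \<in> Pow {..<n}"
    show "p T * p U * y (T \<union> U \<union> W) = p T * p U * z (T \<union> U \<union> W)"
    proof (cases "p T = 0 \<or> p U = 0")
      case False
      then have "card T \<le> t" "card U \<le> t" using p by (auto simp: ml_polys_def)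
      then have "card (T \<union> U \<union> W) \<le> 2 * t + 1"
        using card_Un_le[of "T \<union> U" W] card_Un_le[of T U] W by linarith
      then show ?thesis using eq[of "T \<union> U \<union> W"] TU W by auto
    qed auto
  qed
  have "quad n y p {} = quad n z p {}" "\<And>i. i < n \<Longrightarrow> quad n y p {i} = quad n z p {i}"
    if "p \<in> ml_polys n t" for p
    using that by (auto intro!: quad)
  moreover from this(2) have "(\<Sum>i<n. real_of_int (A l i) * quad n y p {i}) = (\<Sum>i<n. real_of_int (A l i) * quad n z p {i})"
    if "p \<in> ml_polys n t" for p l
    using that by (intro sum.cong) auto
  moreover have "y {} = z {}" by (rule eq) auto
  ultimately show ?thesis unfolding moments_def by simp
qed

section \<open>Bounds on individual moments\<close>

lemma moments_mono:
  assumes mom: "moments t n m A b y" and U: "U \<subseteq> {..<n}" "card U \<le> t"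
  shows "0 \<le> y U" "i < n \<Longrightarrow> 0 \<le> y (insert i U)" "i < n \<Longrightarrow> y (insert i U) \<le> y U"
proof -
  have "ml_mono U \<in> ml_polys n t" using U by (rule ml_mono_in_ml_polys)
  then show "0 \<le> y U" "i < n \<Longrightarrow> 0 \<le> y (insert i U)" "i < n \<Longrightarrow> y (insert i U) \<le> y U"
    using mom quad_mono[OF U(1), of y] by (auto simp: moments_def)
qed

text \<open>Adding one variable to a set of size at most \<open>t\<close> does not increase the
  moment, so induction reaches size \<open>t + 1\<close>.\<close>

lemma moments_unit_interval:
  assumes mom: "moments t n m A b y"
  shows "U \<subseteq> {..<n} \<Longrightarrow> card U \<le> t + 1 \<Longrightarrow> 0 \<le> y U \<and> y U \<le> 1"
proof (induction "card U" arbitrary: U)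
  case 0
  then have "U = {}" using finite_subset by fastforce
  then show ?case using mom by (simp add: moments_def)
next
  case (Suc d)
  then obtain i V where U: "U = insert i V" "i \<notin> V" "card V = d" by (metis card_Suc_eq)
  then show ?case
    using Suc.hyps(1)[of V] Suc.prems Suc.hyps(2) moments_mono[OF mom, where U = V] by force
qed

lemma moments_bounded:
  assumes mom: "moments t n m A b y" and S: "S \<subseteq> {..<n}" "card S \<le> 2 * t + 1"
  shows "\<bar>y S\<bar> \<le> 1"
proof (cases "card S \<le> t + 1")
  case True
  then show ?thesis using moments_unit_interval[OF mom S(1)] by auto
next
  case False
  have fS: "finite S" using S(1) finite_subset by blast
  from False obtain i where i: "i \<in> S" by fastforce
  have c: "card (S - {i}) = card S - 1" using i fS by simp
  with False have "t \<le> card (S - {i})" by simp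
  then obtain U where U: "U \<subseteq> S - {i}" "card U = t" "finite U" by (rule obtain_subset_with_card_n)
  define V where "V = S - {i} - U"
  \<comment> \<open>\<open>(x\<^sub>U \<plusminus> x\<^sub>V)\<^sup>2 x\<^sub>i\<close> has nonnegative pseudo-expectation and its mixed term is \<open>\<plusminus> 2 x\<^sub>S\<close>.\<close>
  have "card V = card S - 1 - t" unfolding V_def using U c by (simp add: card_Diff_subset)
  then have cV: "card V \<le> t" using S by linarith
  have sub: "U \<subseteq> {..<n}" "V \<subseteq> {..<n}" "i < n" using U S i by (auto simp: V_def)
  have SUV: "U \<union> V \<union> {i} = S" using U i by (auto simp: V_def)
  have "0 \<le> y (U \<union> {i}) + 2 * s * y S + s\<^sup>2 * y (V \<union> {i})" for s
  proof -
    have "(\<lambda>T. ml_mono U T + s * ml_mono V T) \<in> ml_polys n t"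
      using U cV sub by (auto simp: ml_mono_def ml_polys_def split: if_splits)
    then have "0 \<le> quad n y (\<lambda>T. ml_mono U T + s * ml_mono V T) {i}"
      using mom sub by (simp add: moments_def)
    then show ?thesis unfolding quad_two_monos[OF sub(1,2)] SUV .
  qed
  from this[of 1] this[of "-1"] have "2 * \<bar>y S\<bar> \<le> y (U \<union> {i}) + y (V \<union> {i})" by auto
  moreover have "y (U \<union> {i}) \<le> 1"
    using moments_unit_interval[OF mom, of "U \<union> {i}"] sub U card_Un_le[of U "{i}"] by auto
  moreover have "y (V \<union> {i}) \<le> 1"
    using moments_unit_interval[OF mom, of "V \<union> {i}"] sub cV card_Un_le[of V "{i}"] by auto
  ultimately show ?thesis by linarith
qed

section \<open>Compactness by Tychonoff's theorem and attained maxima\<close>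

lemma compact_Pi_UNIV:
  fixes B :: "'a \<Rightarrow> 'b::topological_space set"
  assumes "\<And>i. compact (B i)"
  shows "compact (Pi UNIV B)"
proof -
  have "compactin (product_topology (\<lambda>i. euclidean) UNIV) (PiE UNIV B)"
    unfolding compactin_PiE using assms by simp
  then show ?thesis by (simp add: euclidean_product_topology PiE_UNIV_domain)
qed

lemma continuous_on_quad: "continuous_on UNIV (\<lambda>y. quad n y p W)"
  unfolding quad_def by (intro continuous_intros continuous_on_product_coordinates)

lemma closed_moments: "closed {y. moments t n m A b y}"
  unfolding moments_def Ball_def
  by (intro closed_Collect_conj closed_Collect_all closed_Collect_imp closed_Collect_le closed_Collect_eq
      open_Collect_const continuous_intros continuous_on_quad continuous_on_product_coordinates)

lemma maximum_eqI:
  assumes "x \<in> X" "\<And>x'. x' \<in> X \<Longrightarrow> g x' \<le> g x"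
  shows "maximum g X = g x"
  unfolding maximum_def using assms by (intro Greatest_equality) auto

text \<open>\<open>maximum\<close> is defined by \<open>GREATEST\<close>, so it has its meaning only
  once a maximizer is known to exist.\<close>

lemma maximum_attained:
  assumes "\<exists>x\<in>X. \<forall>x'\<in>X. g x' \<le> g x"
  shows "\<exists>x\<in>X. maximum g X = g x" "x' \<in> X \<Longrightarrow> g x' \<le> maximum g X"
proof -
  obtain x where x: "x \<in> X" "\<And>x'. x' \<in> X \<Longrightarrow> g x' \<le> g x" using assms by blast
  have "maximum g X = g x" using x by (rule maximum_eqI)
  then show "\<exists>x\<in>X. maximum g X = g x" "x' \<in> X \<Longrightarrow> g x' \<le> maximum g X"
    using x by auto
qed

lemma sos_relaxation_attains_max:
  assumes "sos_relaxation t n m A b \<noteq> {}"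
  shows "\<exists>x\<in>sos_relaxation t n m A b. \<forall>x'\<in>sos_relaxation t n m A b. dot n c x' \<le> dot n c x"
proof -
  \<comment> \<open>The moments above degree \<open>2 t + 1\<close> are unconstrained; setting them to 0 makes the set compact.\<close>
  define M where "M = Pi UNIV (\<lambda>S::nat set. {-1..1::real}) \<inter> {y. moments t n m A b y}"
  define h where "h y = (\<Sum>i<n. c i * y {i})" for y :: "nat set \<Rightarrow> real"
  have "compact M"
    unfolding M_def using closed_moments by (intro compact_Int_closed compact_Pi_UNIV) auto
  have dot_h: "dot n c (restrict (\<lambda>i. y {i}) {..<n}) = h y" for y
    by (simp add: dot_def h_def)
  have M: "\<exists>z\<in>M. restrict (\<lambda>i. z {i}) {..<n} = restrict (\<lambda>i. y {i}) {..<n}"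
    if y: "moments t n m A b y" for y
  proof
    define z where "z S = (if S \<subseteq> {..<n} \<and> card S \<le> 2 * t + 1 then y S else 0)" for S
    have "moments t n m A b z \<longleftrightarrow> moments t n m A b y" by (rule moments_cong) (simp add: z_def)
    moreover have "\<bar>z S\<bar> \<le> 1" for S using moments_bounded[OF y] by (simp add: z_def)
    ultimately show "z \<in> M" using y by (auto simp: M_def abs_le_iff minus_le_iff)
    show "restrict (\<lambda>i. z {i}) {..<n} = restrict (\<lambda>i. y {i}) {..<n}"
      by (intro restrict_ext) (simp add: z_def)
  qed
  have "M \<noteq> {}" using assms M by (force simp: sos_relaxation_moments)
  moreover have "continuous_on M h"
    unfolding h_def by (intro continuous_intros) (auto intro: continuous_on_subset[OF continuous_on_product_coordinates])
  ultimately obtain y where y: "y \<in> M" "\<And>z. z \<in> M \<Longrightarrow> h z \<le> h y"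
    using continuous_attains_sup[OF \<open>compact M\<close>] by metis
  show ?thesis
  proof (intro bexI ballI)
    show "restrict (\<lambda>i. y {i}) {..<n} \<in> sos_relaxation t n m A b"
      using y by (auto simp: sos_relaxation_moments M_def)
    fix x assume "x \<in> sos_relaxation t n m A b"
    then obtain z where z: "moments t n m A b z" "x = restrict (\<lambda>i. z {i}) {..<n}"
      unfolding sos_relaxation_moments by blast
    from M[OF z(1)] obtain z' where "z' \<in> M" "x = restrict (\<lambda>i. z' {i}) {..<n}"
      using z(2) by auto
    then show "dot n c x \<le> dot n c (restrict (\<lambda>i. y {i}) {..<n})"
      using y(2) by (simp only: dot_h)
  qed
qed

lemma CG_closure_attains_max:
  assumes "CG_closure f n m A b \<noteq> {}"
  shows "\<exists>x\<in>CG_closure f n m A b. \<forall>x'\<in>CG_closure f n m A b. dot n c x' \<le> dot n c x"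
proof (rule continuous_attains_sup)
  have cont: "continuous_on X (dot n u)" for u X
    unfolding dot_def
    by (intro continuous_intros) (auto intro: continuous_on_subset[OF continuous_on_product_coordinates])
  then show "continuous_on (CG_closure f n m A b) (dot n c)" .
  \<comment> \<open>Extensional functions take the single value \<open>undefined\<close> outside the
    index range, so the box is a full product with compact factors.\<close>
  have box: "{..<n} \<rightarrow>\<^sub>E {0..1} = Pi UNIV (\<lambda>i. if i < n then {0..1::real} else {undefined})"
    by (auto simp: PiE_def Pi_def extensional_def split: if_splits)
  have "compact ({..<n} \<rightarrow>\<^sub>E {0..1::real})"
    unfolding box by (rule compact_Pi_UNIV) simp
  moreover have "closed {x. satisfies_system n m A b x \<and>
      (\<forall>\<alpha> \<beta>. rank1_CG_cut f n m A b \<alpha> \<beta> \<longrightarrow> dot n \<alpha> x \<le> real_of_int \<beta>)}"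
    unfolding satisfies_system_def
    by (intro closed_Collect_conj closed_Collect_all closed_Collect_imp closed_Collect_le
        open_Collect_const continuous_on_const cont)
  ultimately have "compact (({..<n} \<rightarrow>\<^sub>E {0..1::real}) \<inter> {x. satisfies_system n m A b x \<and>
      (\<forall>\<alpha> \<beta>. rank1_CG_cut f n m A b \<alpha> \<beta> \<longrightarrow> dot n \<alpha> x \<le> real_of_int \<beta>)})"
    by (rule compact_Int_closed)
  also have "({..<n} \<rightarrow>\<^sub>E {0..1::real}) \<inter> {x. satisfies_system n m A b x \<and>
      (\<forall>\<alpha> \<beta>. rank1_CG_cut f n m A b \<alpha> \<beta> \<longrightarrow> dot n \<alpha> x \<le> real_of_int \<beta>)} = CG_closure f n m A b"
    by (auto simp: CG_closure_def horn_polytope_def)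
  finally show "compact (CG_closure f n m A b)" .
qed (use assms in auto)

text \<open>Evaluation at a 0/1 point is multiplicative even on overlapping monomials. Hence
  \<open>quad\<close> is the square of the value of \<open>p\<close> times \<open>y W\<close>, and
  each constraint is only scaled by a nonnegative factor.\<close>

lemma integer_points_subset_sos_relaxation: "integer_points n m A b \<subseteq> sos_relaxation t n m A b"
proof
  fix x assume x: "x \<in> integer_points n m A b"
  define y where "y S = (\<Prod>i\<in>S. x i)" for S
  have x01: "x i = 0 \<or> x i = 1" if "i < n" for i
    using x that by (auto simp: integer_points_def PiE_def Pi_def)
  have y_Un: "y (T \<union> U) = y T * y U" if "T \<subseteq> {..<n}" "U \<subseteq> {..<n}" for T U
  proof (cases "\<exists>i\<in>T \<union> U. x i = 0")
    case True
    have "finite T" "finite U" using that finite_subset by blast+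
    then have "y (T \<union> U) = 0 \<longleftrightarrow> (\<exists>i\<in>T \<union> U. x i = 0)"
      and "y T = 0 \<longleftrightarrow> (\<exists>i\<in>T. x i = 0)" and "y U = 0 \<longleftrightarrow> (\<exists>i\<in>U. x i = 0)"
      by (simp_all add: y_def)
    then show ?thesis using True by auto
  next
    case False
    then have "x i = 1" if "i \<in> T \<union> U" for i
      using x01[of i] that \<open>T \<subseteq> {..<n}\<close> \<open>U \<subseteq> {..<n}\<close> by auto
    then show ?thesis by (simp add: y_def)
  qed
  have quad: "quad n y p W = (lin n y p)\<^sup>2 * y W" if W: "W \<subseteq> {..<n}" for p W
  proof -
    have "quad n y p W = (\<Sum>T\<in>Pow {..<n}. \<Sum>U\<in>Pow {..<n}. p T * y T * (p U * y U) * y W)"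
      unfolding quad_def
      by (intro sum.cong refl) (use W in \<open>auto simp: y_Un mult_ac\<close>)
    also have "\<dots> = (lin n y p)\<^sup>2 * y W"
      by (simp only: lin_def power2_eq_square sum_product) (simp add: sum_distrib_right)
    finally show ?thesis .
  qed
  have "moments t n m A b y"
    unfolding moments_def
  proof (intro conjI ballI allI impI)
    show "y {} = 1" by (simp add: y_def)
    fix p
    show "0 \<le> quad n y p {}" by (simp add: quad y_def)
    show "0 \<le> quad n y p {i}" "quad n y p {i} \<le> quad n y p {}" if "i < n" for i
      using x01[OF that] that by (auto simp: quad y_def)
    fix l assume "l < m"
    then have "(\<Sum>i<n. real_of_int (A l i) * x i) \<le> real_of_int (b l)"
      using x by (simp add: integer_points_def satisfies_system_def dot_def)
    then have "(lin n y p)\<^sup>2 * (\<Sum>i<n. real_of_int (A l i) * x i) \<le> (lin n y p)\<^sup>2 * real_of_int (b l)"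
      by (intro mult_left_mono) auto
    then show "(\<Sum>i<n. real_of_int (A l i) * quad n y p {i}) \<le> real_of_int (b l) * quad n y p {}"
      by (simp add: quad y_def sum_distrib_left mult_ac)
  qed
  moreover have "x = restrict (\<lambda>i. y {i}) {..<n}"
    using x by (auto simp: y_def integer_points_def PiE_def extensional_def)
  ultimately show "x \<in> sos_relaxation t n m A b" unfolding sos_relaxation_moments by blast
qed


section \<open>Cuts\<close>

lemma Lam_nonneg: "x \<in> Lam f \<Longrightarrow> 0 \<le> x"
  by (auto simp: Lam_def intro: order_trans[rotated])

text \<open>The unrounded cut holds after localization by \<open>p\<close>. Lowering coefficients is
  harmless since \<open>quad n y p {i}\<close> is nonnegative; this accounts for the multipliers of
  the lower bounds.\<close>

lemma moments_row_combination:
  assumes mom: "moments t n m A b y" and p: "p \<in> ml_polys n t"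
    and w: "\<And>l. l < m \<Longrightarrow> 0 \<le> w l"
    and \<alpha>: "\<And>i. i < n \<Longrightarrow> \<alpha> i \<le> (\<Sum>l<m. w l * real_of_int (A l i))"
  shows "(\<Sum>i<n. \<alpha> i * quad n y p {i}) \<le> (\<Sum>l<m. w l * real_of_int (b l)) * quad n y p {}"
proof -
  have "(\<Sum>i<n. \<alpha> i * quad n y p {i}) \<le> (\<Sum>i<n. (\<Sum>l<m. w l * real_of_int (A l i)) * quad n y p {i})"
    using mom p \<alpha> by (intro sum_mono mult_right_mono) (auto simp: moments_def)
  also have "\<dots> = (\<Sum>l<m. w l * (\<Sum>i<n. real_of_int (A l i) * quad n y p {i}))"
    unfolding sum_distrib_left sum_distrib_right by (subst sum.swap) (simp add: mult_ac)
  also have "\<dots> \<le> (\<Sum>l<m. w l * (real_of_int (b l) * quad n y p {}))"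
    using mom p w by (intro sum_mono mult_left_mono) (auto simp: moments_def)
  also have "\<dots> = (\<Sum>l<m. w l * real_of_int (b l)) * quad n y p {}"
    by (simp add: sum_distrib_right mult.assoc)
  finally show ?thesis .
qed

lemma slack_bounded_rows:
  assumes "slack_bounded_Horn_system k n m A b"
  obtains q :: "nat \<Rightarrow> int" and j :: "nat \<Rightarrow> nat" where
    "\<And>l. l < m \<Longrightarrow> 0 \<le> q l" "\<And>l. l < m \<Longrightarrow> q l \<le> int k * b l" "\<And>l. l < m \<Longrightarrow> 0 \<le> b l"
    "\<And>l i. l < m \<Longrightarrow> i < n \<Longrightarrow> - (if i = j l then q l else 0) \<le> A l i"
proof -
  have "\<exists>q j. 0 \<le> q \<and> q \<le> int k * b l \<and> 0 \<le> b l \<and> (\<forall>i<n. - (if i = j then q else 0) \<le> A l i)"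
    if "l < m" for l
    using assms that unfolding slack_bounded_Horn_system_def generalized_Horn_def
    by (smt (verit))
  then obtain q j where "\<forall>l<m. 0 \<le> q l \<and> q l \<le> int k * b l \<and> 0 \<le> b l \<and>
      (\<forall>i<n. - (if i = j l then q l else 0) \<le> A l i)" for l
    by metis
  then show ?thesis using that by blast
qed

text \<open>Rounding down costs less than 1 per coefficient and never makes a nonnegative one
  negative. So each loss that matters is charged to a row with \<open>q \<noteq> 0\<close>
  designating that variable.\<close>

lemma rounded_coeffs_negative_part:
  assumes Horn: "slack_bounded_Horn_system k n m A b" and f: "0 < f"
    and w: "\<And>l. l < m \<Longrightarrow> w l \<in> Lam f"
  shows "\<exists>g :: nat \<Rightarrow> real.
    (\<forall>i<n. 0 \<le> g i \<and> - real_of_int \<lfloor>\<Sum>l<m. w l * real_of_int (A l i)\<rfloor> \<le> g i) \<and>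
    (\<Sum>i<n. g i) \<le> (real k + real f) * (\<Sum>l<m. w l * real_of_int (b l))"
proof -
  obtain q j where q0: "\<And>l. l < m \<Longrightarrow> 0 \<le> q l" and qk: "\<And>l. l < m \<Longrightarrow> q l \<le> int k * b l"
    and b0: "\<And>l. l < m \<Longrightarrow> 0 \<le> b l"
    and A: "\<And>l i. l < m \<Longrightarrow> i < n \<Longrightarrow> - (if i = j l then q l else 0) \<le> A l i"
    using slack_bounded_rows[OF Horn] by metis
  have w0: "0 \<le> w l" if "l < m" for l using w[OF that] by (rule Lam_nonneg)
  \<comment> \<open>The summand \<open>f\<close> pays for rounding: a negative coefficient involves a row with \<open>w l * f \<ge> 1\<close>.\<close>
  define s where "s l = (if q l = 0 then 0 else real_of_int (q l) + real f)" for l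
  define g where "g i = (\<Sum>l<m. w l * (if i = j l then s l else 0))" for i
  have s0: "0 \<le> s l" if "l < m" for l using q0[OF that] by (simp add: s_def)
  have s_le: "s l \<le> (real k + real f) * real_of_int (b l)" if l: "l < m" for l
  proof (cases "q l = 0")
    case False
    \<comment> \<open>Here slack boundedness is essential: a row with a negative entry has
      right-hand side at least 1.\<close>
    then have "b l \<noteq> 0" using q0[OF l] qk[OF l] by auto
    then have b1: "1 \<le> real_of_int (b l)" using b0[OF l] by linarith
    have "real_of_int (q l) \<le> real k * real_of_int (b l)"
      using qk[OF l] by (metis of_int_le_iff of_int_mult of_int_of_nat_eq)
    moreover have "real f \<le> real f * real_of_int (b l)" using b1 by (simp add: mult_le_cancel_left1)
    ultimately show ?thesis using False by (simp add: s_def distrib_right)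
  qed (use b0[OF l] in \<open>simp add: s_def\<close>)
  have g_nonneg: "0 \<le> g i" for i
    unfolding g_def using w0 s0 by (intro sum_nonneg) auto
  have g_neg: "- real_of_int \<lfloor>\<Sum>l<m. w l * real_of_int (A l i)\<rfloor> \<le> g i" if i: "i < n" for i
  proof (cases "0 \<le> (\<Sum>l<m. w l * real_of_int (A l i))")
    case True
    then have "0 \<le> \<lfloor>\<Sum>l<m. w l * real_of_int (A l i)\<rfloor>" by simp
    then show ?thesis using g_nonneg[of i] by linarith
  next
    case False
    then obtain l0 where l0: "l0 < m" "w l0 * real_of_int (A l0 i) < 0"
      by (meson not_le_imp_less sum_nonneg lessThan_iff)
    then have "w l0 \<noteq> 0" "A l0 i < 0" using w0[OF l0(1)] by (auto simp: mult_less_0_iff)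
    then have jl0: "i = j l0" "q l0 \<noteq> 0" using A[OF l0(1) i] by (auto split: if_splits)
    have "1 / real f \<le> w l0" using w[OF l0(1)] \<open>w l0 \<noteq> 0\<close> by (auto simp: Lam_def)
    then have wf: "1 \<le> w l0 * real f" using f by (simp add: field_simps)
    \<comment> \<open>The extra term at row \<open>l0\<close> is at least 1 and absorbs the rounding
      error; \<open>s l0\<close> has room for it because \<open>q l0 \<noteq> 0\<close>.\<close>
    have "- (\<Sum>l<m. w l * real_of_int (A l i)) + w l0 * real f
        = (\<Sum>l<m. w l * (- real_of_int (A l i) + (if l = l0 then real f else 0)))"
    proof -
      have "(\<Sum>l<m. w l * (if l = l0 then real f else 0)) = (\<Sum>l<m. if l = l0 then w l * real f else 0)"
        by (intro sum.cong) auto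
      also have "\<dots> = w l0 * real f" using l0(1) by simp
      finally show ?thesis by (simp add: distrib_left right_diff_distrib sum.distrib sum_subtractf)
    qed
    also have "\<dots> \<le> g i"
      unfolding g_def
    proof (intro sum_mono mult_left_mono)
      fix l assume l: "l \<in> {..<m}"
      then have "- A l i \<le> (if i = j l then q l else 0)" using A[of l i] i by simp
      then have "- real_of_int (A l i) \<le> (if i = j l then real_of_int (q l) else 0)"
        by (simp split: if_split_asm)
      then show "- real_of_int (A l i) + (if l = l0 then real f else 0) \<le> (if i = j l then s l else 0)"
        using jl0 by (cases "l = l0"; cases "q l = 0"; simp add: s_def split: if_split_asm)
    qed (use w0 in auto)
    finally show ?thesis using wf by linarith
  qed
  have "(\<Sum>i<n. g i) = (\<Sum>l<m. w l * (\<Sum>i<n. if i = j l then s l else 0))"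
    unfolding g_def sum_distrib_left by (rule sum.swap)
  also have "\<dots> \<le> (\<Sum>l<m. w l * ((real k + real f) * real_of_int (b l)))"
  proof (intro sum_mono mult_left_mono)
    fix l assume "l \<in> {..<m}"
    then show "(\<Sum>i<n. if i = j l then s l else 0) \<le> (real k + real f) * real_of_int (b l)"
      using s0[of l] s_le[of l] by (auto simp: sum.delta)
  qed (use w0 in auto)
  also have "\<dots> = (real k + real f) * (\<Sum>l<m. w l * real_of_int (b l))"
    by (simp add: sum_distrib_left mult_ac)
  finally show ?thesis using g_nonneg g_neg by blast
qed

text \<open>For a set \<open>W\<close> in the support of \<alpha> with nonzero moment, testing the
  inequality with the monomial of \<open>W\<close> bounds \<open>card W\<close> by \<open>r\<close>
  plus twice the total of \<open>g\<close>. Larger sets thus have moment zero, as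
  \<open>moments_integer_valued\<close> requires.\<close>

lemma moments_satisfy_small_cut:
  fixes w :: "nat \<Rightarrow> real"
  assumes mom: "moments t n m A b y" and Horn: "slack_bounded_Horn_system k n m A b" and f: "0 < f"
    and w: "\<And>l. l < m \<Longrightarrow> w l \<in> Lam f"
  defines "r \<equiv> \<Sum>l<m. w l * real_of_int (b l)"
  assumes K: "(1 + 2 * (real k + real f)) * r \<le> real K" "2 * K + 1 \<le> t"
  shows "(\<Sum>i<n. real_of_int \<lfloor>\<Sum>l<m. w l * real_of_int (A l i)\<rfloor> * y {i}) \<le> real_of_int \<lfloor>r\<rfloor>"
proof -
  define \<alpha> where "\<alpha> i = \<lfloor>\<Sum>l<m. w l * real_of_int (A l i)\<rfloor>" for i
  obtain g where g0: "\<And>i. i < n \<Longrightarrow> 0 \<le> g i"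
    and "\<And>i. i < n \<Longrightarrow> - real_of_int \<lfloor>\<Sum>l<m. w l * real_of_int (A l i)\<rfloor> \<le> g i"
    and "(\<Sum>i<n. g i) \<le> (real k + real f) * (\<Sum>l<m. w l * real_of_int (b l))"
    using rounded_coeffs_negative_part[OF Horn f, of w] w by blast
  then have g: "\<And>i. i < n \<Longrightarrow> - real_of_int (\<alpha> i) \<le> g i"
    and g_sum: "(\<Sum>i<n. g i) \<le> (real k + real f) * r"
    unfolding \<alpha>_def r_def by blast+
  define S where "S = {i. i < n \<and> \<alpha> i \<noteq> 0}"
  have w0: "0 \<le> w l" if "l < m" for l using w[OF that] by (rule Lam_nonneg)
  have valid: "(\<Sum>i<n. real_of_int (\<alpha> i) * quad n y p {i}) \<le> r * quad n y p {}" if "p \<in> ml_polys n t" for p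
    unfolding r_def by (rule moments_row_combination[OF mom that w0]) (simp_all add: \<alpha>_def)
  have vanish: "y W = 0" if W: "W \<subseteq> S" "K < card W" "card W \<le> 2 * K + 1" for W
  proof (rule ccontr)
    assume "y W \<noteq> 0"
    \<comment> \<open>The condition \<open>2 * K + 1 \<le> t\<close> is what makes the monomial of
      \<open>W\<close> an admissible test polynomial.\<close>
    have Wn: "W \<subseteq> {..<n}" "card W \<le> t" using W K by (auto simp: S_def)
    note yW = moments_mono[OF mom Wn]
    have "0 < y W" using yW(1) \<open>y W \<noteq> 0\<close> by simp
    have summand: "(of_bool (i \<in> W) - 2 * g i) * y W \<le> real_of_int (\<alpha> i) * y (insert i W)" if i: "i < n" for i
    proof (cases "i \<in> W")
      case True
      then have "\<alpha> i \<noteq> 0" using W by (auto simp: S_def)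
      \<comment> \<open>If the integer \<open>\<alpha> i\<close> is negative, then
        \<open>g i \<ge> 1\<close>, so one copy of \<open>g i\<close> pays for the 1 and the other
        for \<open>\<alpha> i\<close>. This is the origin of the factor 2 in the bound on
        \<open>K\<close>.\<close>
      then have "1 - 2 * g i \<le> real_of_int (\<alpha> i)"
        using g0[OF i] g[OF i] by (cases "\<alpha> i > 0") auto
      then show ?thesis using True yW(1) by (simp add: insert_absorb mult_right_mono)
    next
      case False
      have "- (g i * y W) \<le> - (g i * y (insert i W))"
        using g0[OF i] yW(3)[OF i] by (simp add: mult_left_mono)
      also have "\<dots> \<le> real_of_int (\<alpha> i) * y (insert i W)"
        using mult_right_mono[OF _ yW(2)[OF i], of "- g i" "real_of_int (\<alpha> i)"] g[OF i] by simp
      moreover have "0 \<le> g i * y W" using g0[OF i] yW(1) by simp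
      ultimately show ?thesis using False by simp
    qed
    have "(real (card W) - 2 * (\<Sum>i<n. g i)) * y W = (\<Sum>i<n. (of_bool (i \<in> W) - 2 * g i) * y W)"
      using Wn by (simp add: sum_subtractf sum_distrib_left sum_distrib_right[symmetric] Int_absorb1)
    also have "\<dots> \<le> (\<Sum>i<n. real_of_int (\<alpha> i) * y (insert i W))"
      by (intro sum_mono summand) auto
    also have "\<dots> \<le> r * y W"
      using valid[OF ml_mono_in_ml_polys[OF Wn]] by (simp add: quad_mono[OF Wn(1)])
    finally have "real (card W) - 2 * (\<Sum>i<n. g i) \<le> r" using \<open>0 < y W\<close> by simp
    then have "real (card W) \<le> (1 + 2 * (real k + real f)) * r"
      using g_sum by (simp add: algebra_simps)
    then show False using W K by simp
  qed
  show ?thesis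
    unfolding \<alpha>_def[symmetric]
    by (rule moments_integer_valued[OF mom _ _ vanish _ valid, where S = S and K = K])
      (use K in \<open>auto simp: S_def\<close>)
qed

lemma scaled_moments_in_CG_closure:
  assumes mom: "moments t n m A b y" and Horn: "slack_bounded_Horn_system k n m A b" and f: "0 < f"
    and \<epsilon>: "0 < \<epsilon>" and K: "(1 + 2 * (real k + real f)) * (1 / \<epsilon> + 1) \<le> real K" "2 * K + 1 \<le> t"
  shows "restrict (\<lambda>i. y {i} / (1 + \<epsilon>)) {..<n} \<in> CG_closure f n m A b"
proof -
  let ?x = "restrict (\<lambda>i. y {i} / (1 + \<epsilon>)) {..<n}"
  have y0: "0 \<le> y {i}" "y {i} \<le> 1" if "i < n" for i
    using moments_mono[OF mom, where U = "{}"] that mom by (auto simp: moments_def)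
  have dot_x: "dot n u ?x = (\<Sum>i<n. u i * y {i}) / (1 + \<epsilon>)" for u
    by (simp add: dot_def sum_divide_distrib)
  have b0: "0 \<le> b l" if "l < m" for l
    using slack_bounded_rows[OF Horn] that by metis
  have scale: "a / (1 + \<epsilon>) \<le> c" if "a \<le> c" "0 \<le> c" for a c :: real
    using that \<epsilon> by (simp add: divide_le_eq distrib_left add_increasing2)
  have one: "ml_mono {} \<in> ml_polys n t" by (rule ml_mono_in_ml_polys) auto
  have q1: "quad n y (ml_mono {}) W = y W" for W by (simp add: quad_mono)
  have "?x \<in> horn_polytope n m A b"
    unfolding horn_polytope_def satisfies_system_def
  proof (intro CollectI conjI allI impI)
    show "?x \<in> {..<n} \<rightarrow>\<^sub>E {0..1}"
      unfolding restrict_PiE_iff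
    proof
      fix i assume "i \<in> {..<n}"
      then show "y {i} / (1 + \<epsilon>) \<in> {0..1}" using y0[of i] \<epsilon> by (simp add: divide_le_eq)
    qed
    fix l assume l: "l < m"
    have "(\<Sum>i<n. real_of_int (A l i) * y {i}) \<le> real_of_int (b l)"
      using mom one l unfolding moments_def by (metis (no_types, lifting) q1 mult.right_neutral sum.cong)
    then show "dot n (\<lambda>i. real_of_int (A l i)) ?x \<le> real_of_int (b l)"
      unfolding dot_x using b0[OF l] by (intro scale) auto
  qed
  moreover have "dot n \<alpha> ?x \<le> real_of_int \<beta>" if cut: "rank1_CG_cut f n m A b \<alpha> \<beta>" for \<alpha> \<beta>
  proof -
    obtain w \<mu> where w: "\<And>l. l < m \<Longrightarrow> w l \<in> Lam f" and \<mu>: "\<And>i. i < n \<Longrightarrow> 0 \<le> \<mu> i"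
      and \<alpha>: "\<And>i. i < n \<Longrightarrow> \<alpha> i = (\<Sum>l<m. w l * real_of_int (A l i)) - \<mu> i"
      and \<alpha>_int: "\<And>i. i < n \<Longrightarrow> \<alpha> i \<in> \<int>"
      and \<beta>: "\<beta> = \<lfloor>\<Sum>l<m. w l * real_of_int (b l)\<rfloor>"
      using cut unfolding rank1_CG_cut_def by blast
    define r where "r = (\<Sum>l<m. w l * real_of_int (b l))"
    have w0: "0 \<le> w l" if "l < m" for l using w[OF that] by (rule Lam_nonneg)
    have "0 \<le> r" unfolding r_def using w0 b0 by (intro sum_nonneg) auto
    then have \<beta>0: "0 \<le> \<beta>" unfolding \<beta> r_def[symmetric] by simp
    have r\<beta>: "r < real_of_int \<beta> + 1" unfolding \<beta> r_def[symmetric] by linarith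
    show ?thesis
    proof (cases "1 / \<epsilon> \<le> real_of_int \<beta>")
      case True
      have "(\<Sum>i<n. \<alpha> i * y {i}) \<le> r"
        using moments_row_combination[OF mom one, of w \<alpha>] w0 \<alpha> \<mu> mom
        by (simp add: q1 r_def moments_def)
      \<comment> \<open>Indeed \<open>r < \<beta> + 1\<close> and
        \<open>1 \<le> \<epsilon> * \<beta>\<close>.\<close>
      also have "\<dots> \<le> real_of_int \<beta> * (1 + \<epsilon>)"
        using r\<beta> True \<epsilon> by (simp add: field_simps)
      finally show ?thesis unfolding dot_x using \<epsilon> by (simp add: divide_le_eq)
    next
      case False
      then have "r \<le> 1 / \<epsilon> + 1" using r\<beta> by linarith
      then have "(1 + 2 * (real k + real f)) * r \<le> (1 + 2 * (real k + real f)) * (1 / \<epsilon> + 1)"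
        by (intro mult_left_mono) auto
      then have rK: "(1 + 2 * (real k + real f)) * r \<le> real K" using K by linarith
      \<comment> \<open>An integral coefficient below the row combination is below its floor, so the
        cut with floored coefficients is the strongest one for \<open>w\<close>.\<close>
      have "(\<Sum>i<n. \<alpha> i * y {i}) \<le> (\<Sum>i<n. real_of_int \<lfloor>\<Sum>l<m. w l * real_of_int (A l i)\<rfloor> * y {i})"
      proof (intro sum_mono mult_right_mono)
        fix i assume "i \<in> {..<n}"
        then have i: "i < n" by simp
        from \<alpha>_int[OF i] obtain a where a: "\<alpha> i = real_of_int a" by (rule Ints_cases)
        then have "a \<le> \<lfloor>\<Sum>l<m. w l * real_of_int (A l i)\<rfloor>"
          using \<alpha>[OF i] \<mu>[OF i] by (simp add: le_floor_iff)
        then show "\<alpha> i \<le> real_of_int \<lfloor>\<Sum>l<m. w l * real_of_int (A l i)\<rfloor>" using a by simp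
      qed (use y0 in auto)
      also have "\<dots> \<le> real_of_int \<beta>"
        unfolding \<beta> using rK K(2) unfolding r_def
        by (intro moments_satisfy_small_cut[OF mom Horn f]) (auto intro: w)
      finally show ?thesis unfolding dot_x using \<beta>0 by (intro scale) auto
    qed
  qed
  ultimately show ?thesis by (simp add: CG_closure_def)
qed

section \<open>Choice of the degree and comparison of the optima\<close>

lemma zero_in_integer_points:
  assumes "slack_bounded_Horn_system k n m A b"
  shows "restrict (\<lambda>_. 0) {..<n} \<in> integer_points n m A b"
proof -
  have "0 \<le> b l" if "l < m" for l
    using slack_bounded_rows[OF assms] that by metis
  then show ?thesis by (auto simp: integer_points_def satisfies_system_def dot_def)
qed

theorem theorem9:
  shows "\<exists>D :: nat \<Rightarrow> nat \<Rightarrow> real \<Rightarrow> nat.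
    (\<exists>C :: real. \<forall>k \<ge> 1. \<forall>f \<ge> 2. \<forall>\<epsilon>. 0 < \<epsilon> \<and> \<epsilon> \<le> 1 \<longrightarrow>
        real (D k f \<epsilon>) \<le> C * (real k + real f) / \<epsilon>) \<and>
    (\<forall>k \<ge> 1. \<forall>f \<ge> 2. \<forall>\<epsilon> > 0.
      \<forall>(n :: nat) (m :: nat) (A :: nat \<Rightarrow> nat \<Rightarrow> int) (b :: nat \<Rightarrow> int) (c :: nat \<Rightarrow> real).
        slack_bounded_Horn_system k n m A b \<and> contains_upper_bounds n m A b \<and>
        (\<forall>i<n. 0 \<le> c i) \<longrightarrow>
          OPT n m A b c \<le> OPT_SoS (D k f \<epsilon>) n m A b c \<and>
          OPT_SoS (D k f \<epsilon>) n m A b c \<le> (1 + \<epsilon>) * OPT_CG f n m A b c)"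
proof -
  define K :: "nat \<Rightarrow> nat \<Rightarrow> real \<Rightarrow> nat"
    where "K k f \<epsilon> = nat \<lceil>(1 + 2 * (real k + real f)) * (1 / \<epsilon> + 1)\<rceil>" for k f \<epsilon>
  show ?thesis
  proof (intro exI[of _ "\<lambda>k f \<epsilon>. 2 * K k f \<epsilon> + 1"] conjI exI[of _ 15] allI impI)
    fix k f :: nat and \<epsilon> :: real
    assume k: "1 \<le> k" and f: "2 \<le> f" and \<epsilon>: "0 < \<epsilon> \<and> \<epsilon> \<le> 1"
    define s where "s = real k + real f"
    have s: "3 \<le> s" using k f by (simp add: s_def)
    have e: "1 \<le> 1 / \<epsilon>" using \<epsilon> by simp
    \<comment> \<open>With \<open>s \<ge> 3\<close> and \<open>\<epsilon> \<le> 1\<close> this gives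
      \<open>K \<le> 14/3 * s / \<epsilon> + 1\<close>. Since also
      \<open>3 \<le> s / \<epsilon>\<close>, \<open>2 * K + 1\<close> is at most
      \<open>31/3 * s / \<epsilon>\<close>, and 15 is a generous constant.\<close>
    have "(1 + 2 * s) * (1 / \<epsilon> + 1) \<le> (7 / 3 * s) * (2 * (1 / \<epsilon>))"
      using s e by (intro mult_mono) auto
    moreover have "1 * 3 \<le> 1 / \<epsilon> * s" using s e \<epsilon> by (intro mult_mono) auto
    moreover have "real (K k f \<epsilon>) \<le> (1 + 2 * s) * (1 / \<epsilon> + 1) + 1"
      unfolding K_def s_def[symmetric] using s e by (simp add: of_nat_ceiling)
    ultimately have "2 * real (K k f \<epsilon>) + 1 \<le> 15 * (1 / \<epsilon> * s)" by simp
    then show "real (2 * K k f \<epsilon> + 1) \<le> 15 * (real k + real f) / \<epsilon>"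
      by (simp add: s_def)
  next
    fix k f :: nat and \<epsilon> :: real and n m :: nat and A :: "nat \<Rightarrow> nat \<Rightarrow> int" and b :: "nat \<Rightarrow> int"
      and c :: "nat \<Rightarrow> real"
    assume f: "2 \<le> f" and \<epsilon>: "0 < \<epsilon>" and
      sys: "slack_bounded_Horn_system k n m A b \<and> contains_upper_bounds n m A b \<and> (\<forall>i<n. 0 \<le> c i)"
    define t where "t = 2 * K k f \<epsilon> + 1"
    have Horn: "slack_bounded_Horn_system k n m A b" using sys by simp
    note zero = zero_in_integer_points[OF Horn]
    let ?I = "integer_points n m A b" and ?R = "sos_relaxation t n m A b"
    have sub: "?I \<subseteq> ?R" by (rule integer_points_subset_sos_relaxation)
    have "finite ({..<n} \<rightarrow>\<^sub>E {0, 1::real})" by (intro finite_PiE) auto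
    then have "finite ?I" by (rule rev_finite_subset) (auto simp: integer_points_def)
    then have fin: "finite (dot n c ` ?I)" by simp
    then have "Max (dot n c ` ?I) \<in> dot n c ` ?I" using zero by (intro Max_in) auto
    then obtain x where x: "x \<in> ?I" "Max (dot n c ` ?I) = dot n c x" by auto
    have OPT_x: "OPT n m A b c = dot n c x"
      unfolding OPT_def
    proof (rule maximum_eqI)
      fix x' assume "x' \<in> ?I"
      then show "dot n c x' \<le> dot n c x" using fin unfolding x(2)[symmetric] by (intro Max_ge) auto
    qed (rule x(1))
    note R_max = sos_relaxation_attains_max[of t n m A b c]
    have R: "?R \<noteq> {}" using sub zero by blast
    show "OPT n m A b c \<le> OPT_SoS (2 * K k f \<epsilon> + 1) n m A b c"
      using maximum_attained(2)[OF R_max[OF R]] x(1) OPT_x sub unfolding OPT_SoS_def t_def by auto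
    obtain y where y: "moments t n m A b y"
      and max: "OPT_SoS t n m A b c = dot n c (restrict (\<lambda>i. y {i}) {..<n})"
      using maximum_attained(1)[OF R_max[OF R]] unfolding OPT_SoS_def sos_relaxation_moments by blast
    let ?x = "restrict (\<lambda>i. y {i} / (1 + \<epsilon>)) {..<n}"
    have in_CG: "?x \<in> CG_closure f n m A b"
    proof (rule scaled_moments_in_CG_closure[OF y Horn _ \<epsilon>])
      show "(1 + 2 * (real k + real f)) * (1 / \<epsilon> + 1) \<le> real (K k f \<epsilon>)"
        unfolding K_def by (rule real_nat_ceiling_ge)
    qed (use f in \<open>auto simp: t_def\<close>)
    \<comment> \<open>The objective is linear, so shrinking an optimal solution into the closure
      costs exactly the factor \<open>1 + \<epsilon>\<close>.\<close>
    have "OPT_SoS t n m A b c = (1 + \<epsilon>) * dot n c ?x"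
      using \<epsilon> by (simp add: max dot_def sum_distrib_left)
    also have "\<dots> \<le> (1 + \<epsilon>) * OPT_CG f n m A b c"
      unfolding OPT_CG_def using in_CG \<epsilon>
      by (intro mult_left_mono maximum_attained(2)[OF CG_closure_attains_max]) auto
    finally show "OPT_SoS (2 * K k f \<epsilon> + 1) n m A b c \<le> (1 + \<epsilon>) * OPT_CG f n m A b c"
      unfolding t_def .
  qed
qed

end
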